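(* Let $n,p,k$ be positive integers with $k\le p$ and $\delta\in(0,1)$. Assume that $\bar\theta\le 1$, where $$\bar\theta:=4\sqrt{\frac{k\log(9ep/k)+\log(1/\delta)}{n}}+4\,\frac{k\log(9ep/k)+\log(1/\delta)}{n}+4\sqrt{\frac{\log(1/\delta)}{n}}.$$ For $\theta>0$ define $$\tau_0=1+4\sqrt{\frac{k\log(9ep/k)+\log(1/\delta)}{n}}+4\,\frac{k\log(9ep/k)+\log(1/\delta)}{n},\qquad \tau_1=1+\theta-2(1+\theta)\sqrt{\frac{\log(1/\delta)}{n}}.$$ Then, for any $\theta>\bar\theta$ and any $\tau\in[\tau_0,\tau_1]$, the test $\psi(\hat\Sigma)=\mathbf 1\{\lambda^k_{\max}(\hat\Sigma)>\tau\}$ discriminates between $H_0$ and $H_1$ with probability $1-\delta$.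
   Context: Write $|v|_2$ for the Euclidean norm and $|v|_0$ for the number of nonzero entries of $v\in\mathbb R^p$, and let $\mathcal B_0(k)=\{v\in\mathbb R^p: |v|_2=1,\ |v|_0\le k\}$. One observes i.i.d. copies $X_1,\dots,X_n$ of a random vector $X\in\mathbb R^p$. The hypotheses are $H_0$: $X\sim\mathcal N(0,I_p)$; and $H_1$: $X\sim\mathcal N(0,I_p+\theta vv^\top)$ for some $v\in\mathcal B_0(k)$, where $\theta>0$. The empirical covariance matrix is $\hat\Sigma=\frac1n\sum_{i=1}^nX_iX_i^\top$. For a symmetric $p\times p$ matrix $A$, the $k$-sparse largest eigenvalue is $\lambda^k_{\max}(A)=\max_{x\in\mathcal B_0(k)}x^\top Ax$ (equivalently, $\max_{|S|=k}\lambda_{\max}(A_S)$ over subsets $S\subset\{1,\dots,p\}$, $A_S$ being the principal submatrix indexed by $S$). A test $\psi$ (with values in $\{0,1\}$) discriminates between $H_0$ and $H_1$ with probability $1-\delta$ if its type I error (probability that $\psi=1$ under $H_0$) and its type II error (probability that $\psi=0$ under $H_1$, for every $v\in\mathcal B_0(k)$) are both at most $\delta$. *)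

theory Defs
  imports "HOL-Probability.Probability"
begin

definition outer :: "real^'p \<Rightarrow> real^'p \<Rightarrow> real^'p^'p" where
  "outer x y = (\<chi> i j. x $ i * y $ j)"

definition sparse_sphere :: "nat \<Rightarrow> (real^'p::finite) set" where
  "sparse_sphere k = {v. norm v = 1 \<and> card {i. v $ i \<noteq> 0} \<le> k}"

(* For k \<ge> 1 the index set is compact and nonempty, so the supremum is a maximum. *)
definition sparse_max_eig :: "nat \<Rightarrow> real^'p^'p::finite \<Rightarrow> real" where
  "sparse_max_eig k A = (SUP x\<in>sparse_sphere k. x \<bullet> (A *v x))"

definition std_mvnormal :: "(real^'p::finite) measure" where
  "std_mvnormal =
     distr (\<Pi>\<^sub>M i\<in>(UNIV :: 'p set). density lborel (\<lambda>x. ennreal (std_normal_density x))) borel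
       (\<lambda>z. \<chi> i. z i)"

(* N(mu, Sigma) is the law of mu + A Z, where Z is standard normal and A A^T = Sigma.
   It does not depend on the choice of A. Such an A exists iff Sigma is symmetric
   positive semidefinite; for any other Sigma the definition carries no meaning. *)
definition mvnormal :: "real^'p \<Rightarrow> real^'p^'p \<Rightarrow> (real^'p::finite) measure" where
  "mvnormal \<mu> \<Sigma> =
     distr std_mvnormal borel
       (\<lambda>z. \<mu> + (SOME A :: real^'p^'p. A ** transpose A = \<Sigma>) *v z)"

definition spiked_cov :: "real \<Rightarrow> real^'p \<Rightarrow> real^'p^'p::finite" where
  "spiked_cov \<theta> v = mat 1 + \<theta> *\<^sub>R outer v v"

lemma mat_1_has_root: "\<exists>A :: real^'p^'p::finite. A ** transpose A = mat 1"
  by (rule exI[of _ "mat 1"]) (simp add: transpose_mat)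

lemma spiked_cov_has_root:
  fixes v :: "real^'p::finite"
  assumes "norm v = 1" "\<theta> \<ge> 0"
  shows "\<exists>A :: real^'p^'p. A ** transpose A = spiked_cov \<theta> v"
proof -
  define c where "c = sqrt (1 + \<theta>) - 1"
  have c: "2 * c + c * c = \<theta>"
    using assms(2) by (simp add: c_def algebra_simps)
  have "v \<bullet> v = 1"
    using assms(1) by (simp add: dot_square_norm)
  hence vv: "(\<Sum>k\<in>UNIV. v $ k * v $ k) = 1"
    by (simp add: inner_vec_def)
  define A where "A = mat 1 + c *\<^sub>R outer v v"
  have tr: "transpose A = A"
    by (auto simp: A_def transpose_def outer_def mat_def vec_eq_iff mult.commute)
  have oo: "outer v v ** outer v v = outer v v"
  proof -
    have "(\<Sum>k\<in>UNIV. v $ i * v $ k * (v $ k * v $ j)) = v $ i * v $ j" for i j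
    proof -
      have "(\<Sum>k\<in>UNIV. v $ i * v $ k * (v $ k * v $ j))
              = v $ i * v $ j * (\<Sum>k\<in>UNIV. v $ k * v $ k)"
        by (simp add: sum_distrib_left mult_ac)
      thus ?thesis by (simp add: vv)
    qed
    thus ?thesis by (simp add: outer_def matrix_matrix_mult_def vec_eq_iff)
  qed
  have left: "(M + N) ** B = M ** B + N ** B" for M N B :: "real^'p^'p"
    by (simp add: matrix_matrix_mult_def vec_eq_iff sum.distrib algebra_simps)
  have scale: "(r *\<^sub>R M) ** B = r *\<^sub>R (M ** B)" "M ** (r *\<^sub>R B) = r *\<^sub>R (M ** B)"
    for r and M B :: "real^'p^'p"
    by (simp_all add: matrix_matrix_mult_def vec_eq_iff sum_distrib_left mult_ac)
  have "A ** A = mat 1 + (2 * c + c * c) *\<^sub>R outer v v"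
    by (simp add: A_def matrix_add_ldistrib left scale oo scaleR_add_left)
       (simp add: scaleR_add_right flip: scaleR_add_left)
  hence "A ** transpose A = spiked_cov \<theta> v"
    unfolding tr c spiked_cov_def .
  thus ?thesis by blast
qed

(* Joint law of n i.i.d. observations with common law L. *)
definition iid_law :: "nat \<Rightarrow> 'a measure \<Rightarrow> (nat \<Rightarrow> 'a) measure" where
  "iid_law n L = (\<Pi>\<^sub>M i\<in>{1..n}. L)"

definition emp_cov :: "nat \<Rightarrow> (nat \<Rightarrow> real^'p) \<Rightarrow> real^'p^'p::finite" where
  "emp_cov n X = (1 / real n) *\<^sub>R (\<Sum>i=1..n. outer (X i) (X i))"

(* A test is a measurable function of the empirical covariance matrix with values in {0, 1};
   measurability is part of the notion, since "measure" is 0 on non-measurable sets. *)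
definition discriminates ::
    "nat \<Rightarrow> nat \<Rightarrow> real \<Rightarrow> real \<Rightarrow> (real^'p^'p::finite \<Rightarrow> nat) \<Rightarrow> bool" where
  "discriminates n k \<theta> \<delta> \<psi> \<longleftrightarrow>
     \<psi> \<in> borel \<rightarrow>\<^sub>M count_space {0, 1} \<and>
     \<P>(X in iid_law n (mvnormal 0 (mat 1)). \<psi> (emp_cov n X) = 1) \<le> \<delta> \<and>
     (\<forall>v\<in>sparse_sphere k.
        \<P>(X in iid_law n (mvnormal 0 (spiked_cov \<theta> v)). \<psi> (emp_cov n X) = 0) \<le> \<delta>)"

definition sparse_eig_test :: "nat \<Rightarrow> real \<Rightarrow> real^'p^'p::finite \<Rightarrow> nat" where
  "sparse_eig_test k \<tau> A = of_bool (sparse_max_eig k A > \<tau>)"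

definition rate :: "nat \<Rightarrow> nat \<Rightarrow> nat \<Rightarrow> real \<Rightarrow> real" where
  "rate n p k \<delta> = (real k * ln (9 * exp 1 * real p / real k) + ln (1 / \<delta>)) / real n"

definition theta_bar :: "nat \<Rightarrow> nat \<Rightarrow> nat \<Rightarrow> real \<Rightarrow> real" where
  "theta_bar n p k \<delta> =
     4 * sqrt (rate n p k \<delta>) + 4 * rate n p k \<delta> + 4 * sqrt (ln (1 / \<delta>) / real n)"

definition tau0 :: "nat \<Rightarrow> nat \<Rightarrow> nat \<Rightarrow> real \<Rightarrow> real" where
  "tau0 n p k \<delta> = 1 + 4 * sqrt (rate n p k \<delta>) + 4 * rate n p k \<delta>"

definition tau1 :: "nat \<Rightarrow> real \<Rightarrow> real \<Rightarrow> real" where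
  "tau1 n \<theta> \<delta> = 1 + \<theta> - 2 * (1 + \<theta>) * sqrt (ln (1 / \<delta>) / real n)"

end

theory Submission
  imports Defs
begin

text \<open>
  For a unit vector x the projections of the observations on x are independent centred normals, so
  n times the quadratic form of the empirical covariance at x is a scaled chi-square variable, and
  the Chernoff method gives the Laurent--Massart tails. Under the alternative the
  lower tail at x = v suffices. Under the null hypothesis, the quadratic form of the empirical
  covariance minus the identity is at most twice its largest absolute value on a 1/4-net of each
  coordinate sphere; there are (p choose k) spheres of dimension k - 1 with nets of
  at most 9^k points, and the resulting union bound, whose factor 2 for the two tails is absorbed by
  2 (p choose k) \<le> (ep/k)^k, costs exactly the term k log(9ep/k).
\<close>

section \<open>Gaussian laws\<close>

lemma borel_measurable_vec_lambda:
  fixes f :: "'a \<Rightarrow> 'p::finite \<Rightarrow> real"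
  assumes "\<And>i. (\<lambda>z. f z i) \<in> borel_measurable M"
  shows "(\<lambda>z. \<chi> i. f z i) \<in> borel_measurable M"
  using assms by (subst borel_measurable_euclidean_space) (auto simp: Basis_vec_def inner_axis)

lemma prob_space_std_normal: "prob_space std_normal_distribution"
  by (rule prob_space_normal_density) simp

lemma prob_space_std_mvnormal: "prob_space (std_mvnormal :: (real^'p::finite) measure)"
proof -
  interpret product_prob_space "\<lambda>_::'p. std_normal_distribution" UNIV
    by (simp add: product_prob_space_def product_prob_space_axioms_def product_sigma_finite_def
        prob_space_std_normal prob_space_imp_sigma_finite)
  show ?thesis
    unfolding std_mvnormal_def by (rule prob_space_distr, rule borel_measurable_vec_lambda) simp
qed

lemma sets_std_mvnormal [measurable_cong, simp]: "sets std_mvnormal = sets borel"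
  by (simp add: std_mvnormal_def)

text \<open>The terms \<open>b $ i * z i\<close> are independent centred normals with standard
  deviations \<open>\<bar>b $ i\<bar>\<close>, and their variances add up to the squared norm of
  \<open>b\<close>, which is 1.\<close>

lemma distr_inner_std_mvnormal:
  fixes b :: "real^'p::finite"
  assumes "norm b = 1"
  shows "distr std_mvnormal borel (\<lambda>z. b \<bullet> z) = std_normal_distribution"
proof -
  let ?P = "\<Pi>\<^sub>M i\<in>(UNIV::'p set). std_normal_distribution"
  \<comment> \<open>Coordinates with zero coefficient are dropped: they contribute the constant 0,
    which has no density, and the addition rule for normals asks for positive standard
    deviations.\<close>
  define J where "J = {i. b $ i \<noteq> 0}"
  interpret product_prob_space "\<lambda>_::'p. std_normal_distribution" UNIV
    by (simp add: product_prob_space_def product_prob_space_axioms_def product_sigma_finite_def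
        prob_space_std_normal prob_space_imp_sigma_finite)
  have vec[measurable]: "(\<lambda>z. \<chi> i. z i) \<in> borel_measurable (\<Pi>\<^sub>M i\<in>(UNIV::'p set). std_normal_distribution)"
    by (rule borel_measurable_vec_lambda) simp
  have J: "J \<noteq> {}"
    using assms by (metis (mono_tags, lifting) J_def empty_iff mem_Collect_eq norm_zero vec_eq_iff zero_index zero_neq_one)
  have comp: "distributed ?P lborel (\<lambda>z. z i) std_normal_density" for i :: 'p
    unfolding distributed_def using PiM_component[of i]
    by (auto simp: cong: distr_cong)
  have normal: "distributed ?P lborel (\<lambda>z. b $ i * z i) (normal_density 0 \<bar>b $ i\<bar>)" if "i \<in> J" for i
    using P.normal_density_affine[OF comp, of "b $ i" 0 i] that by (simp add: J_def)
  \<comment> \<open>Restricting the product law to \<open>J\<close> gives the product of its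
    one-dimensional marginals, which is independence.\<close>
  have "P.indep_vars (\<lambda>_. std_normal_distribution) (\<lambda>i z. z i) J"
  proof (subst P.indep_vars_iff_distr_eq_PiM')
    have "distr (\<Pi>\<^sub>M i\<in>UNIV. std_normal_distribution) (\<Pi>\<^sub>M i\<in>J. std_normal_distribution) (\<lambda>z. \<lambda>i\<in>J. z i)
        = (\<Pi>\<^sub>M i\<in>J. std_normal_distribution)"
      using distr_restrict[of J UNIV] by simp
    thus "distr (\<Pi>\<^sub>M i\<in>UNIV. std_normal_distribution) (\<Pi>\<^sub>M i\<in>J. std_normal_distribution) (\<lambda>z. \<lambda>i\<in>J. z i)
        = (\<Pi>\<^sub>M i\<in>J. distr (\<Pi>\<^sub>M i\<in>UNIV. std_normal_distribution) std_normal_distribution (\<lambda>z. z i))"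
      using PiM_component by simp
  qed (use J in auto)
  hence "P.indep_vars (\<lambda>_. borel) (\<lambda>i. (\<lambda>x. b $ i * x) \<circ> (\<lambda>z. z i)) J"
    by (rule P.indep_vars_compose) auto
  hence "distributed ?P lborel (\<lambda>z. \<Sum>i\<in>J. b $ i * z i) (normal_density (\<Sum>i\<in>J. 0) (sqrt (\<Sum>i\<in>J. \<bar>b $ i\<bar>\<^sup>2)))"
    using J normal by (intro P.sum_indep_normal) (auto simp: o_def J_def)
  moreover have "(\<Sum>i\<in>J. \<bar>b $ i\<bar>\<^sup>2) = 1"
  proof -
    have "(\<Sum>i\<in>J. \<bar>b $ i\<bar>\<^sup>2) = (\<Sum>i\<in>UNIV. \<bar>b $ i\<bar>\<^sup>2)"
      by (rule sum.mono_neutral_left) (auto simp: J_def)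
    thus ?thesis
      using assms by (simp add: norm_vec_def L2_set_def)
  qed
  moreover have "(\<Sum>i\<in>J. b $ i * z i) = b \<bullet> (\<chi> i. z i)" for z
    unfolding inner_vec_def by (simp, rule sum.mono_neutral_left) (auto simp: J_def)
  ultimately have "distributed ?P lborel (\<lambda>z. b \<bullet> (\<chi> i. z i)) std_normal_density"
    by simp
  hence "distr ?P lborel (\<lambda>z. b \<bullet> (\<chi> i. z i)) = std_normal_distribution"
    by (simp add: distributed_def)
  thus ?thesis
    unfolding std_mvnormal_def
    by (subst distr_distr) (auto simp: o_def cong: distr_cong)
qed

lemma borel_measurable_matrix_vector_mult [measurable (raw)]:
  fixes A :: "real^'n::finite^'m::finite"
  assumes "g \<in> borel_measurable M"
  shows "(\<lambda>z. A *v g z) \<in> borel_measurable M"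
  using assms borel_measurable_continuous_onI[OF matrix_vector_mult_linear_continuous_on]
  by (rule measurable_compose)

lemma prob_space_mvnormal: "prob_space (mvnormal \<mu> \<Sigma> :: (real^'p::finite) measure)"
  unfolding mvnormal_def
  by (intro prob_space.prob_space_distr prob_space_std_mvnormal)
     measurable

lemma sets_mvnormal [measurable_cong, simp]: "sets (mvnormal \<mu> \<Sigma>) = sets borel"
  by (simp add: mvnormal_def)

text \<open>With \<open>A\<close> the chosen root of \<Sigma>, the projection of
  \<open>A *v z\<close> on \<open>x\<close> equals the projection of \<open>z\<close> on
  \<open>x v* A\<close>, and the squared norm of that vector is
  \<open>x \<bullet> (\<Sigma> *v x)\<close>. So only the variance enters, not the choice of the
  root; \<open>root\<close> ensures that the choice operator in \<open>mvnormal\<close> returns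
  one.\<close>

lemma distr_inner_mvnormal:
  fixes x :: "real^'p::finite"
  assumes root: "\<exists>A :: real^'p^'p. A ** transpose A = \<Sigma>"
    and var: "x \<bullet> (\<Sigma> *v x) = \<sigma>\<^sup>2" and \<sigma>: "\<sigma> > 0"
  shows "distr (mvnormal 0 \<Sigma>) borel (\<lambda>X. (x \<bullet> X) / \<sigma>) = std_normal_distribution"
proof -
  define A where "A = (SOME A :: real^'p^'p. A ** transpose A = \<Sigma>)"
  have A: "A ** transpose A = \<Sigma>"
    unfolding A_def using root by (rule someI_ex)
  define b where "b = (1 / \<sigma>) *\<^sub>R (x v* A)"
  have "(x v* A) \<bullet> (x v* A) = x \<bullet> (A *v (transpose A *v x))"
    by (simp add: dot_lmul_matrix)
  also have "\<dots> = \<sigma>\<^sup>2"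
    by (simp only: matrix_vector_mul_assoc A var)
  finally have "norm (x v* A) = \<sigma>"
    using \<sigma> by (simp add: norm_eq_sqrt_inner)
  hence "norm b = 1"
    using \<sigma> by (simp add: b_def)
  moreover have "(x \<bullet> (A *v z)) / \<sigma> = b \<bullet> z" for z
    by (simp add: b_def dot_lmul_matrix)
  ultimately show ?thesis
    unfolding mvnormal_def A_def[symmetric]
    by (subst distr_distr) (auto simp: o_def distr_inner_std_mvnormal)
qed

section \<open>Chi-square tails\<close>

text \<open>Both sides vanish at 1, and the derivative of the difference is the square
  \<open>(1 - 1 / x)\<^sup>2 / 2\<close>. At \<open>y = 1 / (1 - 2 * s)\<close> this bounds the
  logarithm of the chi-square moment generating function for the upper tail.\<close>

lemma ln_le_half_diff_inverse:
  fixes y :: real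
  assumes "1 \<le> y"
  shows "ln y \<le> (y - 1 / y) / 2"
proof -
  have "(\<lambda>y::real. (y - 1 / y) / 2 - ln y) 1 \<le> (\<lambda>y. (y - 1 / y) / 2 - ln y) y"
  proof (rule DERIV_nonneg_imp_nondecreasing[OF assms])
    fix x :: real assume x: "1 \<le> x" "x \<le> y"
    have "((\<lambda>y. (y - 1 / y) / 2 - ln y) has_real_derivative (1 - 1 / x)\<^sup>2 / 2) (at x)"
      using x by (auto intro!: derivative_eq_intros simp: field_simps power2_eq_square)
    thus "\<exists>d. ((\<lambda>y. (y - 1 / y) / 2 - ln y) has_real_derivative d) (at x) \<and> 0 \<le> d"
      by (intro exI[of _ "(1 - 1 / x)\<^sup>2 / 2"]) auto
  qed
  thus ?thesis by simp
qed

text \<open>Both sides vanish at 0 and the derivative of the difference is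
  \<open>x\<^sup>2 / (1 + x)\<close>. It serves the lower tail.\<close>

lemma ln_one_plus_ge:
  fixes w :: real
  assumes "0 \<le> w"
  shows "w - w\<^sup>2 / 2 \<le> ln (1 + w)"
proof -
  have "(\<lambda>w::real. ln (1 + w) - (w - w\<^sup>2 / 2)) 0 \<le> (\<lambda>w. ln (1 + w) - (w - w\<^sup>2 / 2)) w"
  proof (rule DERIV_nonneg_imp_nondecreasing[OF assms])
    fix x :: real assume x: "0 \<le> x" "x \<le> w"
    have "((\<lambda>w. ln (1 + w) - (w - w\<^sup>2 / 2)) has_real_derivative x\<^sup>2 / (1 + x)) (at x)"
      using x by (auto intro!: derivative_eq_intros simp: field_simps power2_eq_square)
    thus "\<exists>d. ((\<lambda>w. ln (1 + w) - (w - w\<^sup>2 / 2)) has_real_derivative d) (at x) \<and> 0 \<le> d"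
      using x by (intro exI[of _ "x\<^sup>2 / (1 + x)"]) auto
  qed
  thus ?thesis by simp
qed

text \<open>The moment generating function of a squared standard normal: tilting the density gives
  \<sigma> times the centred normal density of variance \<open>1 / (1 - 2 * s)\<close>, which
  integrates to \<sigma>.\<close>

lemma nn_integral_exp_square_std_normal:
  fixes s :: real
  assumes "s < 1/2"
  shows "(\<integral>\<^sup>+x. ennreal (exp (s * x\<^sup>2)) \<partial>density lborel std_normal_density) = ennreal (1 / sqrt (1 - 2 * s))"
proof -
  define \<sigma> where "\<sigma> = 1 / sqrt (1 - 2 * s)"
  have \<sigma>: "\<sigma> > 0" "\<sigma>\<^sup>2 = 1 / (1 - 2 * s)"
    using assms by (auto simp: \<sigma>_def power_divide)
  have "std_normal_density x * exp (s * x\<^sup>2) = \<sigma> * normal_density 0 \<sigma> x" for x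
  proof -
    have "- x\<^sup>2 / 2 + s * x\<^sup>2 = - x\<^sup>2 / (2 * \<sigma>\<^sup>2)"
      using assms unfolding \<sigma> by (simp add: field_simps)
    moreover have "1 / sqrt (2 * pi) = \<sigma> / sqrt (2 * pi * \<sigma>\<^sup>2)"
      using \<sigma>(1) by (simp add: real_sqrt_mult)
    ultimately show ?thesis
      by (simp add: normal_density_def flip: exp_add)
  qed
  hence "(\<integral>\<^sup>+x. ennreal (exp (s * x\<^sup>2)) \<partial>density lborel std_normal_density)
      = (\<integral>\<^sup>+x. ennreal (\<sigma> * normal_density 0 \<sigma> x) \<partial>lborel)"
    by (simp add: nn_integral_density flip: ennreal_mult)
  also have "\<dots> = ennreal (LBINT x. \<sigma> * normal_density 0 \<sigma> x)"
    using \<sigma> by (intro nn_integral_eq_integral) auto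
  also have "\<dots> = ennreal \<sigma>"
    using \<sigma> by simp
  finally show ?thesis by (simp add: \<sigma>_def)
qed

lemma prob_space_iid_law: "prob_space L \<Longrightarrow> prob_space (iid_law n L)"
  unfolding iid_law_def by (rule prob_space_PiM)

lemma measurable_iid_law_component [measurable (raw)]:
  "i \<in> {1..n} \<Longrightarrow> f \<in> measurable L N \<Longrightarrow> (\<lambda>X. f (X i)) \<in> measurable (iid_law n L) N"
  unfolding iid_law_def by simp

text \<open>Markov's inequality for the exponential of the sum, whose expectation factors over the
  product law. Any tilt is part of \<open>f\<close>, so the Chernoff parameter is 1.\<close>

lemma iid_law_exp_tail:
  assumes L: "prob_space L" and f[measurable]: "f \<in> borel_measurable L"
    and m: "(\<integral>\<^sup>+x. ennreal (exp (f x)) \<partial>L) = ennreal m" "0 \<le> m"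
  shows "measure (iid_law n L) {X\<in>space (iid_law n L). a \<le> (\<Sum>i=1..n. f (X i))} \<le> exp (- a) * m ^ n"
proof -
  interpret L: prob_space L by fact
  interpret product_prob_space "\<lambda>_. L" "{1..n}"
    by (simp add: product_prob_space_def product_prob_space_axioms_def product_sigma_finite_def L
        prob_space_imp_sigma_finite)
  let ?M = "iid_law n L"
  interpret M: prob_space ?M by (rule prob_space_iid_law) fact
  have "emeasure ?M {X\<in>space ?M. a \<le> (\<Sum>i=1..n. f (X i))}
      \<le> ennreal (exp (- 1 * a)) * (\<integral>\<^sup>+X. ennreal (exp (1 * (\<Sum>i=1..n. f (X i)))) * indicator (space ?M) X \<partial>?M)"
    by (rule Chernoff_ineq_nn_integral_ge) auto
  also have "(\<integral>\<^sup>+X. ennreal (exp (1 * (\<Sum>i=1..n. f (X i)))) * indicator (space ?M) X \<partial>?M)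
      = (\<integral>\<^sup>+X. (\<Prod>i=1..n. ennreal (exp (f (X i)))) \<partial>?M)"
    by (intro nn_integral_cong) (simp add: exp_sum prod_ennreal)
  also have "\<dots> = (\<Prod>i=1..n. \<integral>\<^sup>+x. ennreal (exp (f x)) \<partial>L)"
    unfolding iid_law_def by (rule product_nn_integral_prod) auto
  also have "\<dots> = ennreal (m ^ n)"
    using m by (simp add: ennreal_power)
  finally show ?thesis
    using m(2) by (simp add: M.emeasure_eq_measure flip: ennreal_mult)
qed

lemma nn_integral_exp_square_of_distr:
  assumes [measurable]: "g \<in> borel_measurable L"
    and g: "distr L borel g = std_normal_distribution" and "s < 1/2"
  shows "(\<integral>\<^sup>+x. ennreal (exp (s * (g x)\<^sup>2)) \<partial>L) = ennreal (1 / sqrt (1 - 2 * s))"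
proof -
  have "(\<integral>\<^sup>+x. ennreal (exp (s * (g x)\<^sup>2)) \<partial>L) = (\<integral>\<^sup>+y. ennreal (exp (s * y\<^sup>2)) \<partial>distr L borel g)"
    by (simp add: nn_integral_distr)
  thus ?thesis
    by (simp add: g nn_integral_exp_square_std_normal[OF \<open>s < 1/2\<close>])
qed

lemma sqrt_power_eq_exp: "0 < y \<Longrightarrow> sqrt y ^ n = exp (real n * (ln y / 2))"
  by (simp add: exp_of_nat_mult flip: ln_sqrt)

text \<open>The Laurent--Massart upper tail in the parametrization \<open>t = n * u\<^sup>2\<close>,
  where the usual threshold \<open>n + 2 * sqrt (n * t) + 2 * t\<close> becomes
  \<open>n * (1 + 2 * u + 2 * u\<^sup>2)\<close>.\<close>

lemma chi_square_upper_tail: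
  assumes L: "prob_space L" and g[measurable]: "g \<in> borel_measurable L"
    and distr: "distr L borel g = std_normal_distribution" and u: "0 \<le> u"
  shows "measure (iid_law n L) {X\<in>space (iid_law n L).
      real n * (1 + 2 * u + 2 * u\<^sup>2) \<le> (\<Sum>i=1..n. (g (X i))\<^sup>2)} \<le> exp (- (real n * u\<^sup>2))"
proof -
  interpret M: prob_space "iid_law n L" by (rule prob_space_iid_law) fact
  \<comment> \<open>The centred log moment generating function is at most
    \<open>s\<^sup>2 / (1 - 2 * s)\<close>; this tilt maximizes
    \<open>s * (2 * u + 2 * u\<^sup>2) - s\<^sup>2 / (1 - 2 * s)\<close>, and the maximum is
    \<open>u\<^sup>2\<close>.\<close>
  define s where "s = u / (1 + 2 * u)"
  define a where "a = real n * (1 + 2 * u + 2 * u\<^sup>2)"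
  have s: "0 \<le> s" "s < 1/2" "1 - 2 * s = 1 / (1 + 2 * u)"
    using u by (auto simp: s_def field_simps)
  have m: "(\<integral>\<^sup>+x. ennreal (exp (s * (g x)\<^sup>2)) \<partial>L) = ennreal (sqrt (1 + 2 * u))"
    using nn_integral_exp_square_of_distr[OF g distr s(2)] by (simp add: s(3) real_sqrt_divide)
  have "measure (iid_law n L) {X\<in>space (iid_law n L). a \<le> (\<Sum>i=1..n. (g (X i))\<^sup>2)}
      \<le> measure (iid_law n L) {X\<in>space (iid_law n L). s * a \<le> (\<Sum>i=1..n. s * (g (X i))\<^sup>2)}"
    using s(1) by (intro M.finite_measure_mono) (auto simp flip: sum_distrib_left intro: mult_left_mono)
  also have "\<dots> \<le> exp (- (s * a)) * sqrt (1 + 2 * u) ^ n"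
    using u by (intro iid_law_exp_tail L m) auto
  also have "\<dots> = exp (- (s * a) + real n * (ln (1 + 2 * u) / 2))"
    using u by (simp add: sqrt_power_eq_exp mult_exp_exp)
  also have "\<dots> \<le> exp (- (real n * u\<^sup>2))"
  proof -
    have "ln (1 + 2 * u) / 2 \<le> (1 + 2 * u - 1 / (1 + 2 * u)) / 4"
      using ln_le_half_diff_inverse[of "1 + 2 * u"] u by simp
    also have "\<dots> = s * (1 + 2 * u + 2 * u\<^sup>2) - u\<^sup>2"
      using u by (simp add: s_def divide_simps) (simp add: algebra_simps power2_eq_square)
    finally have "real n * (ln (1 + 2 * u) / 2) \<le> real n * (s * (1 + 2 * u + 2 * u\<^sup>2) - u\<^sup>2)"
      by (rule mult_left_mono) simp
    thus ?thesis by (simp add: a_def algebra_simps)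
  qed
  finally show ?thesis by (simp add: a_def)
qed

text \<open>The Laurent--Massart lower tail, with the same \<open>t = n * u\<^sup>2\<close> and
  threshold \<open>n - 2 * sqrt (n * t)\<close>.\<close>

lemma chi_square_lower_tail:
  assumes L: "prob_space L" and g[measurable]: "g \<in> borel_measurable L"
    and distr: "distr L borel g = std_normal_distribution" and u: "0 \<le> u"
  shows "measure (iid_law n L) {X\<in>space (iid_law n L).
      (\<Sum>i=1..n. (g (X i))\<^sup>2) \<le> real n * (1 - 2 * u)} \<le> exp (- (real n * u\<^sup>2))"
proof -
  interpret M: prob_space "iid_law n L" by (rule prob_space_iid_law) fact
  define a where "a = real n * (1 - 2 * u)"
  \<comment> \<open>A negative tilt turns the lower tail into an upper one. For tilt
    \<open>- r\<close>, the exponent per observation is at most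
    \<open>r\<^sup>2 - 2 * u * r\<close>, with minimum \<open>- u\<^sup>2\<close> at
    \<open>r = u\<close>.\<close>
  have m: "(\<integral>\<^sup>+x. ennreal (exp (- u * (g x)\<^sup>2)) \<partial>L) = ennreal (1 / sqrt (1 + 2 * u))"
    using nn_integral_exp_square_of_distr[OF g distr, of "- u"] u by simp
  have "measure (iid_law n L) {X\<in>space (iid_law n L). (\<Sum>i=1..n. (g (X i))\<^sup>2) \<le> a}
      \<le> measure (iid_law n L) {X\<in>space (iid_law n L). - u * a \<le> (\<Sum>i=1..n. - u * (g (X i))\<^sup>2)}"
    using u by (intro M.finite_measure_mono)
      (auto simp: sum_negf simp flip: sum_distrib_left intro: mult_left_mono)
  also have "\<dots> \<le> exp (- (- u * a)) * (1 / sqrt (1 + 2 * u)) ^ n"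
    using u by (intro iid_law_exp_tail L m) auto
  also have "\<dots> = exp (u * a - real n * (ln (1 + 2 * u) / 2))"
    using u by (simp add: power_divide sqrt_power_eq_exp exp_diff)
  also have "\<dots> \<le> exp (- (real n * u\<^sup>2))"
  proof -
    have "u * (1 - 2 * u) + u\<^sup>2 \<le> ln (1 + 2 * u) / 2"
      using ln_one_plus_ge[of "2 * u"] u by (simp add: algebra_simps power2_eq_square)
    hence "real n * (u * (1 - 2 * u) + u\<^sup>2) \<le> real n * (ln (1 + 2 * u) / 2)"
      by (rule mult_left_mono) simp
    thus ?thesis by (simp add: a_def algebra_simps)
  qed
  finally show ?thesis by (simp add: a_def)
qed

section \<open>Nets of coordinate spheres\<close>

definition coord_sphere :: "'p set \<Rightarrow> (real^'p::finite) set" where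
  "coord_sphere S = {x. norm x = 1 \<and> (\<forall>i. i \<notin> S \<longrightarrow> x $ i = 0)}"

text \<open>Since \<open>k \<le> CARD('p)\<close>, a smaller support can be enlarged to exactly
  \<open>k\<close> coordinates. Hence the union bound runs over \<open>CARD('p) choose k\<close>
  sets and all nets share one size bound.\<close>

lemma sparse_sphere_subset_coord_spheres:
  assumes "k \<le> CARD('p::finite)"
  shows "sparse_sphere k \<subseteq> (\<Union>S\<in>{S. card S = k}. coord_sphere S :: (real^'p) set)"
proof
  fix v :: "real^'p" assume v: "v \<in> sparse_sphere k"
  have "\<exists>S. {i. v $ i \<noteq> 0} \<subseteq> S \<and> S \<subseteq> UNIV \<and> card S = k"
    using v assms by (intro exists_subset_between) (auto simp: sparse_sphere_def)
  thus "v \<in> (\<Union>S\<in>{S. card S = k}. coord_sphere S)"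
    using v by (auto simp: sparse_sphere_def coord_sphere_def)
qed

lemma norm_eq_L2_set:
  fixes x :: "real^'p::finite"
  assumes "\<And>i. i \<notin> S \<Longrightarrow> x $ i = 0"
  shows "norm x = L2_set (\<lambda>i. x $ i) S"
proof -
  have "(\<Sum>i\<in>S. (x $ i)\<^sup>2) = (\<Sum>i\<in>UNIV. (x $ i)\<^sup>2)"
    by (rule sum.mono_neutral_left) (auto simp: assms)
  thus ?thesis by (simp add: norm_vec_def L2_set_def)
qed

(* The slab is a full-dimensional substitute for the r-ball around c inside the coordinate
   subspace of S, so that Lebesgue measure can be used for the volume comparison. *)
definition slab :: "'p set \<Rightarrow> real \<Rightarrow> real^'p \<Rightarrow> (real^'p::finite) set" where
  "slab S r c = {y. L2_set (\<lambda>i. y $ i - c $ i) S \<le> r \<and> (\<forall>i. i \<notin> S \<longrightarrow> \<bar>y $ i\<bar> \<le> 1)}"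

lemma compact_unit_slab: "compact (slab S 1 0)"
proof -
  have "closed (slab S 1 0)"
    unfolding slab_def L2_set_def
    by (intro closed_Collect_conj closed_Collect_le closed_Collect_all closed_Collect_imp
        continuous_intros) simp_all
  moreover have "slab S 1 0 \<subseteq> cbox (-1) 1"
  proof
    fix y assume y: "y \<in> slab S 1 (0::real^'a)"
    have "\<bar>y $ i\<bar> \<le> 1" for i
    proof (cases "i \<in> S")
      case True
      have "\<bar>y $ i\<bar> = L2_set (\<lambda>i. y $ i) {i}" by simp
      also have "\<dots> \<le> L2_set (\<lambda>i. y $ i) S"
        unfolding L2_set_def using True by (intro real_sqrt_le_mono sum_mono2) auto
      finally show ?thesis using y by (simp add: slab_def)
    qed (use y in \<open>auto simp: slab_def\<close>)
    thus "y \<in> cbox (-1) 1"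
      by (simp add: mem_box_cart abs_le_iff minus_le_iff)
  qed
  ultimately show ?thesis
    using bounded_cbox bounded_subset compact_eq_bounded_closed by blast
qed

text \<open>The slab contains the Euclidean unit ball. Positivity allows its volume to be cancelled
  in the packing argument.\<close>

lemma measure_unit_slab_pos: "measure lebesgue (slab S 1 (0::real^'p::finite)) > 0"
proof -
  have "L2_set (\<lambda>i. y $ i) S \<le> norm y" for y :: "real^'p"
    unfolding norm_vec_def L2_set_def by (intro real_sqrt_le_mono) (auto intro: sum_mono2)
  hence "y \<in> slab S 1 0" if "norm y \<le> 1" for y :: "real^'p"
    using that component_le_norm_cart[of y] by (auto simp: slab_def intro: order_trans[OF _ that])
  hence "cball 0 1 \<subseteq> slab S 1 (0::real^'p)"
    by auto
  hence "measure lebesgue (cball (0::real^'p) 1) \<le> measure lebesgue (slab S 1 0)"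
    by (intro measure_mono_fmeasurable) (auto intro: lmeasurable_compact compact_unit_slab)
  moreover have "measure lebesgue (cball (0::real^'p) 1) > 0"
    using content_cball_pos[of 1 "0::real^'p"] by (simp add: measure_completion)
  ultimately show ?thesis by linarith
qed

text \<open>The slab is the image of the unit slab under stretching the coordinates in
  \<open>S\<close> by \<open>r\<close> and translating by \<open>c\<close>, so only
  \<open>card S\<close> coordinates scale. As \<open>c\<close> vanishes off \<open>S\<close>, the
  translation preserves the bounds there.\<close>

lemma slab_measure:
  fixes c :: "real^'p::finite"
  assumes r: "0 < r" and c: "\<And>i. i \<notin> S \<Longrightarrow> c $ i = 0"
  shows "slab S r c \<in> lmeasurable"
    and "measure lebesgue (slab S r c) = r ^ card S * measure lebesgue (slab S 1 (0::real^'p))"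
proof -
  define m where "m = (\<lambda>i. if i \<in> S then r else 1)"
  let ?f = "\<lambda>x::real^'p. \<chi> i. m i * x $ i"
  have m: "m i \<noteq> 0" for i using r by (auto simp: m_def)
  have *: "L2_set (\<lambda>i. m i * x $ i) S = r * L2_set (\<lambda>i. x $ i) S" for x :: "real^'p"
    using r by (simp add: m_def L2_set_right_distrib cong: L2_set_cong)
  have "slab S r c = (+) c ` ?f ` slab S 1 0"
  proof (intro set_eqI iffI)
    fix y assume y: "y \<in> slab S r c"
    define x where "x = (\<chi> i. (y $ i - c $ i) / m i)"
    have yx: "y = c + ?f x"
      using m by (simp add: x_def vec_eq_iff)
    have "r * L2_set (\<lambda>i. x $ i) S \<le> r"
      using y unfolding *[symmetric] by (simp add: slab_def yx)
    hence "L2_set (\<lambda>i. x $ i) S \<le> 1" using r by simp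
    moreover have "\<bar>x $ i\<bar> \<le> 1" if "i \<notin> S" for i
      using y that by (simp add: slab_def x_def m_def c)
    ultimately have "x \<in> slab S 1 0"
      by (simp add: slab_def)
    thus "y \<in> (+) c ` ?f ` slab S 1 0" using yx by blast
  next
    fix y assume "y \<in> (+) c ` ?f ` slab S 1 0"
    then obtain x where "x \<in> slab S 1 0" "y = c + ?f x" by auto
    thus "y \<in> slab S r c"
      using r by (simp add: slab_def * ) (auto simp: m_def c)
  qed
  moreover have "?f ` slab S 1 0 \<in> lmeasurable"
    by (intro measurable_stretch lmeasurable_compact compact_unit_slab)
  moreover have "measure lebesgue (?f ` slab S 1 0) = r ^ card S * measure lebesgue (slab S 1 (0::real^'p))"
    using r by (subst measure_stretch)
      (auto intro: lmeasurable_compact compact_unit_slab simp: m_def prod.If_cases power_abs)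
  ultimately show "slab S r c \<in> lmeasurable"
    and "measure lebesgue (slab S r c) = r ^ card S * measure lebesgue (slab S 1 (0::real^'p))"
    by (auto simp: measurable_translation measure_translation)
qed

text \<open>Volume packing: the slabs of radius 1/8 around the points are disjoint and lie in the
  slab of radius 9/8 around 0, so there are at most \<open>((9/8) / (1/8)) ^ card S\<close> of
  them.\<close>

lemma card_separated_le:
  fixes N :: "(real^'p::finite) set"
  assumes N: "finite N" "N \<subseteq> coord_sphere S"
    and sep: "pairwise (\<lambda>x y. dist x y > 1/4) N"
  shows "card N \<le> 9 ^ card S"
proof -
  let ?\<mu> = "measure lebesgue (slab S 1 (0::real^'p))"
  have supp: "x $ i = 0" if "x \<in> N" "i \<notin> S" for x i
    using that N by (auto simp: coord_sphere_def)
  have tri: "L2_set (\<lambda>i. a $ i - b $ i) S \<le> L2_set (\<lambda>i. y $ i - a $ i) S + L2_set (\<lambda>i. y $ i - b $ i) S"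
    for a b y :: "real^'p"
    using L2_set_triangle_ineq[of "\<lambda>i. a $ i - y $ i" "\<lambda>i. y $ i - b $ i" S]
    by (simp add: L2_set_def power2_commute)
  have disj: "pairwise (\<lambda>x y. disjnt (slab S (1/8) x) (slab S (1/8) y)) N"
  proof (rule pairwiseI)
    \<comment> \<open>Points of \<open>N\<close> vanish off \<open>S\<close>, so the seminorm over
      \<open>S\<close> that defines slabs is their Euclidean distance.\<close>
    fix a b assume ab: "a \<in> N" "b \<in> N" "a \<noteq> b"
    have "L2_set (\<lambda>i. a $ i - b $ i) S = dist a b"
      using norm_eq_L2_set[of S "a - b"] supp ab by (simp add: dist_norm)
    hence "L2_set (\<lambda>i. a $ i - b $ i) S > 1/4"
      using sep ab by (auto simp: pairwise_def)
    moreover have "L2_set (\<lambda>i. a $ i - b $ i) S \<le> 1/4"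
      if "y \<in> slab S (1/8) a" "y \<in> slab S (1/8) b" for y
      using tri[of a b y] that by (simp add: slab_def)
    ultimately show "disjnt (slab S (1/8) a) (slab S (1/8) b)"
      unfolding disjnt_iff by (meson not_le)
  qed
  have sub: "slab S (1/8) x \<subseteq> slab S (9/8) 0" if "x \<in> N" for x
  proof
    fix y assume y: "y \<in> slab S (1/8) x"
    have "L2_set (\<lambda>i. x $ i) S = 1"
      using norm_eq_L2_set[of S x] supp that N by (auto simp: coord_sphere_def)
    moreover have "L2_set (\<lambda>i. y $ i) S \<le> L2_set (\<lambda>i. y $ i - x $ i) S + L2_set (\<lambda>i. x $ i) S"
      using L2_set_triangle_ineq[of "\<lambda>i. y $ i - x $ i" "\<lambda>i. x $ i" S] by simp
    ultimately show "y \<in> slab S (9/8) 0"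
      using y by (auto simp: slab_def)
  qed
  have meas: "slab S (1/8) x \<in> lmeasurable" if "x \<in> N" for x
    using supp that by (intro slab_measure) auto
  have "real (card N) * ((1/8) ^ card S * ?\<mu>) = (\<Sum>x\<in>N. measure lebesgue (slab S (1/8) x))"
    using supp by (simp add: slab_measure(2)[of "1/8"])
  also have "\<dots> = measure lebesgue (\<Union>x\<in>N. slab S (1/8) x)"
    using N(1) meas disj by (rule measure_UNION'[symmetric])
  also have "\<dots> \<le> measure lebesgue (slab S (9/8) (0::real^'p))"
    using sub meas N(1)
    by (intro measure_mono_fmeasurable slab_measure(1)) (auto intro!: fmeasurableD fmeasurable.finite_UN)
  also have "\<dots> = (9/8) ^ card S * ?\<mu>"
    by (rule slab_measure) auto
  finally have "real (card N) * (1/8) ^ card S \<le> (9/8) ^ card S"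
    using measure_unit_slab_pos[of S] by (simp flip: mult.assoc)
  hence "real (card N) \<le> 9 ^ card S"
    by (simp add: power_divide field_simps)
  thus ?thesis
    by (metis of_nat_le_iff of_nat_numeral of_nat_power)
qed

text \<open>A 1/4-separated set of maximal cardinality is a net, since a point far from all its
  members could be added. The packing bound makes the maximum exist.\<close>

lemma ex_coord_sphere_net:
  fixes S :: "'p::finite set"
  obtains N :: "(real^'p) set" where "finite N" "N \<subseteq> coord_sphere S" "card N \<le> 9 ^ card S"
    "\<And>x. x \<in> coord_sphere S \<Longrightarrow> \<exists>y\<in>N. dist x y \<le> 1/4"
proof -
  define P where "P = (\<lambda>N. finite N \<and> N \<subseteq> (coord_sphere S :: (real^'p) set)
      \<and> pairwise (\<lambda>x y. dist x y > 1/4) N)"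
  have le: "P N \<Longrightarrow> card N \<le> 9 ^ card S" for N
    using card_separated_le by (auto simp: P_def)
  have "P {}" by (simp add: P_def)
  then obtain N where N: "P N" and max: "\<And>N'. P N' \<Longrightarrow> card N' \<le> card N"
    using ex_has_greatest_nat[of P "{}" card "Suc (9 ^ card S)"] le by (metis le_imp_less_Suc)
  show ?thesis
  proof
    fix x :: "real^'p" assume x: "x \<in> coord_sphere S"
    show "\<exists>y\<in>N. dist x y \<le> 1/4"
    proof (rule ccontr)
      assume "\<not> ?thesis"
      hence far: "dist x y > 1/4" if "y \<in> N" for y
        using that by force
      hence "x \<notin> N" by force
      moreover have "P (insert x N)"
        using N x far by (auto simp: P_def pairwise_insert dist_commute)
      ultimately show False
        using max[of "insert x N"] N by (simp add: P_def)
    qed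
  qed (use N le in \<open>auto simp: P_def\<close>)
qed

section \<open>Quadratic forms: from a net to the whole sphere\<close>

text \<open>Serves to show that suprema of a quadratic form over unit vectors are finite.\<close>

lemma abs_quadratic_form_le:
  fixes A :: "real^'p::finite^'p"
  shows "\<bar>x \<bullet> (A *v x)\<bar> \<le> onorm ((*v) A) * (norm x)\<^sup>2"
proof -
  have "\<bar>x \<bullet> (A *v x)\<bar> \<le> norm x * norm (A *v x)"
    by (rule Cauchy_Schwarz_ineq2)
  also have "\<dots> \<le> norm x * (onorm ((*v) A) * norm x)"
    by (intro mult_left_mono onorm matrix_vector_mul_bounded_linear) simp
  finally show ?thesis by (simp add: power2_eq_square mult_ac)
qed

text \<open>Let \<open>L\<close> be the supremum of the absolute form over the sphere. Moving to a
  net point within distance 1/4 changes the form by at most \<open>L / 2\<close>, so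
  \<open>L \<le> M + L / 2\<close>; as \<open>L\<close> is finite, this gives
  \<open>L \<le> 2 * M\<close>.\<close>

lemma quadratic_form_net_bound:
  fixes A :: "real^'p::finite^'p"
  assumes N: "N \<subseteq> coord_sphere S" and net: "\<And>x. x \<in> coord_sphere S \<Longrightarrow> \<exists>y\<in>N. dist x y \<le> 1/4"
    and M: "\<And>y. y \<in> N \<Longrightarrow> \<bar>y \<bullet> (A *v y)\<bar> \<le> M" and x0: "x0 \<in> coord_sphere S"
  shows "\<bar>x0 \<bullet> (A *v x0)\<bar> \<le> 2 * M"
proof -
  define q where "q = (\<lambda>x. x \<bullet> (A *v x))"
  define L where "L = (SUP x\<in>coord_sphere S. \<bar>q x\<bar>)"
  have bdd: "bdd_above ((\<lambda>x. \<bar>q x\<bar>) ` coord_sphere S)"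
  proof (rule bdd_aboveI2)
    show "\<bar>q x\<bar> \<le> onorm ((*v) A)" if "x \<in> coord_sphere S" for x
      using abs_quadratic_form_le[of x A] that by (simp add: q_def coord_sphere_def)
  qed
  \<comment> \<open>By homogeneity the bound extends to all vectors supported in \<open>S\<close>;
    it is applied to combinations of \<open>x\<close> and \<open>y\<close> that need not be unit
    vectors.\<close>
  have q_le: "\<bar>q z\<bar> \<le> L * (norm z)\<^sup>2" if "\<And>i. i \<notin> S \<Longrightarrow> z $ i = 0" for z
  proof (cases "z = 0")
    case False
    hence "(1 / norm z) *\<^sub>R z \<in> coord_sphere S"
      using that by (simp add: coord_sphere_def)
    hence "\<bar>q ((1 / norm z) *\<^sub>R z)\<bar> \<le> L"
      unfolding L_def using bdd by (rule cSUP_upper)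
    moreover have "q ((1 / norm z) *\<^sub>R z) = q z / (norm z)\<^sup>2"
      by (simp add: q_def matrix_vector_mult_scaleR power2_eq_square)
    ultimately show ?thesis
      using False by (simp add: abs_divide field_simps)
  qed (simp add: q_def)
  have "\<bar>q x\<bar> \<le> M + L / 2" if x: "x \<in> coord_sphere S" for x
  proof -
    obtain y where y: "y \<in> N" and d: "dist x y \<le> 1/4" using net[OF x] by blast
    hence y': "y \<in> coord_sphere S" using N by auto
    let ?a = "9 *\<^sub>R x - 7 *\<^sub>R y" and ?b = "9 *\<^sub>R y - 7 *\<^sub>R x"
    (* Polarization: q x - q y is the bilinear form at x + y and x - y; the weights 9 and 7
       balance the norms of these two vectors. *)
    have "q x - q y = (q ?a - q ?b) / 32"
      by (simp add: q_def matrix_vector_mult_diff_distrib matrix_vector_mult_scaleR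
          inner_diff_left inner_diff_right)
    moreover have "\<bar>q ?a\<bar> \<le> L * (norm ?a)\<^sup>2" "\<bar>q ?b\<bar> \<le> L * (norm ?b)\<^sup>2"
      using x y' by (auto intro!: q_le simp: coord_sphere_def)
    hence "\<bar>q ?a - q ?b\<bar> \<le> L * ((norm ?a)\<^sup>2 + (norm ?b)\<^sup>2)"
      unfolding distrib_left by linarith
    ultimately have diff: "\<bar>q x - q y\<bar> \<le> L * ((norm ?a)\<^sup>2 + (norm ?b)\<^sup>2) / 32"
      by (simp only: abs_divide abs_numeral) (simp add: divide_right_mono)
    have xx: "x \<bullet> x = 1" "y \<bullet> y = 1"
      using x y' by (simp_all add: coord_sphere_def dot_square_norm)
    have "(dist x y)\<^sup>2 \<le> (1/4)\<^sup>2" using d by (intro power_mono) auto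
    hence "2 - 2 * (x \<bullet> y) \<le> 1/16"
      unfolding dist_norm power2_norm_eq_inner
      by (simp add: inner_diff_left inner_diff_right xx inner_commute power2_eq_square)
    \<comment> \<open>The sum equals \<open>260 - 252 * (x \<bullet> y)\<close>, and
      \<open>x \<bullet> y \<ge> 31/32\<close> makes it at most 15.875. Division by 32 then yields
      the factor 1/2.\<close>
    hence "(norm ?a)\<^sup>2 + (norm ?b)\<^sup>2 \<le> 16"
      by (simp add: power2_norm_eq_inner inner_diff_left inner_diff_right xx inner_commute)
    moreover have "0 \<le> L"
      unfolding L_def by (rule order_trans[OF abs_ge_zero cSUP_upper[OF x bdd]])
    ultimately have "L * ((norm ?a)\<^sup>2 + (norm ?b)\<^sup>2) \<le> L * 16"
      by (intro mult_left_mono) auto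
    thus ?thesis using diff M[OF y] unfolding q_def by linarith
  qed
  hence "L \<le> M + L / 2"
    unfolding L_def using x0 by (intro cSUP_least) auto
  moreover have "\<bar>q x0\<bar> \<le> L"
    unfolding L_def using x0 bdd by (rule cSUP_upper)
  ultimately show ?thesis by (simp add: q_def)
qed

section \<open>The sparse largest eigenvalue test\<close>

lemma quadratic_form_emp_cov:
  "x \<bullet> (emp_cov n X *v x) = (\<Sum>i=1..n. (x \<bullet> X i)\<^sup>2) / real n"
proof -
  have outer: "outer y y *v x = (x \<bullet> y) *\<^sub>R y" for y
    by (simp add: outer_def matrix_vector_mult_def vec_eq_iff inner_vec_def sum_distrib_left mult_ac)
  have "(\<Sum>i\<in>I. outer (X i) (X i)) *v x = (\<Sum>i\<in>I. (x \<bullet> X i) *\<^sub>R X i)" for I :: "nat set"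
    by (induction I rule: infinite_finite_induct)
       (simp_all add: matrix_vector_mult_add_rdistrib outer)
  hence "x \<bullet> (emp_cov n X *v x) = (1 / real n) * (x \<bullet> (\<Sum>i=1..n. (x \<bullet> X i) *\<^sub>R X i))"
    by (simp only: emp_cov_def inner_scaleR_right flip: scaleR_matrix_vector_assoc)
  thus ?thesis
    by (simp add: inner_sum_right power2_eq_square)
qed

lemma quadratic_form_emp_cov_minus_id:
  assumes "norm x = 1"
  shows "x \<bullet> ((emp_cov n X - mat 1) *v x) = (\<Sum>i=1..n. (x \<bullet> X i)\<^sup>2) / real n - 1"
  using assms by (simp add: matrix_vector_mult_diff_rdistrib inner_diff_right quadratic_form_emp_cov
      dot_square_norm)

text \<open>A supremum over a nonempty bounded set exceeds \<tau> exactly when some member does.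
  Coordinate vectors give nonemptiness because \<open>1 \<le> k\<close>.\<close>

lemma less_sparse_max_eig_iff:
  fixes A :: "real^'p::finite^'p"
  assumes "1 \<le> k"
  shows "\<tau> < sparse_max_eig k A \<longleftrightarrow> (\<exists>x\<in>sparse_sphere k. \<tau> < x \<bullet> (A *v x))"
  unfolding sparse_max_eig_def
proof (rule less_cSUP_iff)
  have "axis i 1 \<in> sparse_sphere k" for i :: 'p
    using assms by (simp add: sparse_sphere_def axis_def if_distrib norm_axis_1[unfolded axis_def] cong: if_cong)
  thus "sparse_sphere k \<noteq> ({} :: (real^'p) set)" by blast
  have "x \<bullet> (A *v x) \<le> onorm ((*v) A)" if "x \<in> sparse_sphere k" for x
    using abs_quadratic_form_le[of x A] that by (simp add: sparse_sphere_def)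
  thus "bdd_above ((\<lambda>x. x \<bullet> (A *v x)) ` sparse_sphere k)"
    by (rule bdd_aboveI2)
qed

text \<open>The rejection region is a union of open half-spaces of matrices, one for each sparse
  unit vector, hence open even though the union is uncountable.\<close>

lemma measurable_sparse_eig_test:
  assumes "1 \<le> k"
  shows "(sparse_eig_test k \<tau> :: real^'p::finite^'p \<Rightarrow> nat) \<in> borel \<rightarrow>\<^sub>M count_space {0, 1}"
proof -
  have "open {A :: real^'p^'p. \<tau> < x \<bullet> (A *v x)}" for x
    unfolding inner_vec_def matrix_vector_mult_def
    by (intro open_Collect_less continuous_intros)
  hence "open {A :: real^'p^'p. \<tau> < sparse_max_eig k A}"
    unfolding less_sparse_max_eig_iff[OF assms] by (auto simp: Collect_bex_eq)
  hence "Measurable.pred borel (\<lambda>A :: real^'p^'p. \<tau> < sparse_max_eig k A)"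
    by (simp add: pred_def borel_open)
  thus ?thesis
    unfolding sparse_eig_test_def of_bool_def by measurable
qed

section \<open>Counting supports\<close>

text \<open>A weak Stirling bound. The factor 2 comes from \<open>2 \<le> exp 1\<close> at
  \<open>k = 1\<close>, and \<open>(1 + 1 / real k) ^ k \<le> exp 1\<close> carries it through the
  induction.\<close>

lemma two_mult_power_self_le: "1 \<le> k \<Longrightarrow> 2 * real k ^ k \<le> exp 1 ^ k * fact k"
proof (induction k rule: nat_induct_at_least)
  case base
  show ?case using exp_ge_add_one_self[of 1] by simp
next
  case (Suc k)
  have "real (Suc k) ^ k = (1 + 1 / real k) ^ k * real k ^ k"
    using Suc.hyps by (simp add: field_simps flip: power_mult_distrib)
  also have "(1 + 1 / real k) ^ k \<le> exp (1 / real k) ^ k"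
    by (intro power_mono exp_ge_add_one_self) simp
  also have "exp (1 / real k) ^ k = exp 1"
    using Suc.hyps by (simp flip: exp_of_nat_mult)
  finally have "real (Suc k) ^ k \<le> exp 1 * real k ^ k"
    by (simp add: mult_right_mono)
  hence "2 * real (Suc k) ^ Suc k \<le> real (Suc k) * exp 1 * (2 * real k ^ k)"
    by (simp add: mult_left_mono)
  also have "\<dots> \<le> real (Suc k) * exp 1 * (exp 1 ^ k * fact k)"
    using Suc.IH by (intro mult_left_mono) simp_all
  finally show ?case by (simp add: mult_ac)
qed

text \<open>Combine \<open>(p choose k) * fact k \<le> p ^ k\<close> with the factorial bound. The
  spare factor 2 pays for the two tails in the union bound.\<close>

lemma two_mult_binomial_le:
  assumes "1 \<le> k"
  shows "2 * real (p choose k) \<le> (exp 1 * real p / real k) ^ k"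
proof -
  have k: "real k ^ k > 0" "(fact k :: real) > 0" using assms by auto
  have "real (p choose k) * fact k \<le> real p ^ k"
    using of_nat_mono[OF binomial_fact_pow[of p k], where 'a = real] by simp
  hence "(real (p choose k) * fact k) * (2 * real k ^ k) \<le> real p ^ k * (exp 1 ^ k * fact k)"
    using two_mult_power_self_le[OF assms] by (rule mult_mono) auto
  hence "(2 * real (p choose k)) * real k ^ k \<le> real p ^ k * exp 1 ^ k"
    using k by (simp add: mult_ac)
  thus ?thesis
    using k by (simp add: power_divide power_mult_distrib pos_le_divide_eq mult_ac)
qed

section \<open>Error probabilities\<close>

text \<open>Under the null the projections on \<open>x\<close> are standard normal, so both
  chi-square tails apply. The lower tail already starts at deviation \<open>2 * u\<close>, which is
  at most \<open>2 * u + 2 * u\<^sup>2\<close>.\<close>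

lemma measure_abs_quadratic_form_deviation:
  fixes x :: "real^'p::finite"
  assumes n: "1 \<le> n" and x: "norm x = 1" and u: "0 \<le> u"
  defines "M \<equiv> iid_law n (mvnormal 0 (mat 1))"
  shows "{X\<in>space M. 2 * u + 2 * u\<^sup>2 < \<bar>x \<bullet> ((emp_cov n X - mat 1) *v x)\<bar>} \<in> sets M" (is "?B \<in> _")
    and "measure M {X\<in>space M. 2 * u + 2 * u\<^sup>2 < \<bar>x \<bullet> ((emp_cov n X - mat 1) *v x)\<bar>}
      \<le> 2 * exp (- (real n * u\<^sup>2))"
proof -
  let ?L = "mvnormal 0 (mat 1) :: (real^'p) measure"
  interpret M: prob_space M
    unfolding M_def by (intro prob_space_iid_law prob_space_mvnormal)
  have distr: "distr ?L borel (\<lambda>X. x \<bullet> X) = std_normal_distribution"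
    using distr_inner_mvnormal[of "mat 1" x 1] mat_1_has_root x by (simp add: dot_square_norm)
  have g: "(\<lambda>X. x \<bullet> X) \<in> borel_measurable ?L" by measurable
  define U where "U = {X\<in>space M. real n * (1 + 2 * u + 2 * u\<^sup>2) \<le> (\<Sum>i=1..n. (x \<bullet> X i)\<^sup>2)}"
  define D where "D = {X\<in>space M. (\<Sum>i=1..n. (x \<bullet> X i)\<^sup>2) \<le> real n * (1 - 2 * u)}"
  have meas: "(\<lambda>X. \<Sum>i=1..n. (x \<bullet> X i)\<^sup>2) \<in> borel_measurable M"
    unfolding M_def by measurable
  note [measurable] = meas
  have UD: "U \<in> sets M" "D \<in> sets M" unfolding U_def D_def by measurable
  show B: "?B \<in> sets M"
    unfolding quadratic_form_emp_cov_minus_id[OF x] by measurable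
  have "?B \<subseteq> U \<union> D"
  proof
    fix X assume "X \<in> ?B"
    hence X: "X \<in> space M" and "2 * u + 2 * u\<^sup>2 < \<bar>(\<Sum>i=1..n. (x \<bullet> X i)\<^sup>2) / real n - 1\<bar>"
      by (auto simp: quadratic_form_emp_cov_minus_id[OF x])
    hence "1 + 2 * u + 2 * u\<^sup>2 \<le> (\<Sum>i=1..n. (x \<bullet> X i)\<^sup>2) / real n
        \<or> (\<Sum>i=1..n. (x \<bullet> X i)\<^sup>2) / real n \<le> 1 - 2 * u"
      using zero_le_power2[of u] by linarith
    thus "X \<in> U \<union> D"
      using X n by (simp add: U_def D_def field_simps)
  qed
  hence "measure M ?B \<le> measure M U + measure M D"
    using UD B M.finite_measure_mono[of ?B "U \<union> D"] measure_Un_le[of U M D]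
    by (auto intro: order_trans)
  also have "\<dots> \<le> exp (- (real n * u\<^sup>2)) + exp (- (real n * u\<^sup>2))"
    unfolding U_def D_def M_def
    by (intro add_mono chi_square_upper_tail chi_square_lower_tail prob_space_mvnormal g distr u)
  finally show "measure M ?B \<le> 2 * exp (- (real n * u\<^sup>2))" by simp
qed

text \<open>The rate is calibrated for this: with \<open>u\<^sup>2\<close> equal to it, one
  chi-square tail is \<delta> divided by the bound for twice the total number of net points.\<close>

lemma exp_rate:
  assumes "1 \<le> n" "1 \<le> k" "1 \<le> p" "0 < \<delta>"
  shows "exp (- (real n * rate n p k \<delta>)) = \<delta> / (9 * exp 1 * real p / real k) ^ k"
proof -
  have pos: "0 < 9 * exp 1 * real p / real k" using assms by simp
  have "real n * rate n p k \<delta> = real k * ln (9 * exp 1 * real p / real k) + ln (1 / \<delta>)"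
    using assms by (simp add: rate_def)
  hence "- (real n * rate n p k \<delta>) = ln \<delta> - real k * ln (9 * exp 1 * real p / real k)"
    using assms by (simp add: ln_div)
  thus ?thesis
    using pos assms by (simp only: exp_diff exp_of_nat_mult exp_ln)
qed

lemma rate_nonneg:
  assumes "1 \<le> k" "k \<le> p" "0 < \<delta>" "\<delta> < 1"
  shows "0 \<le> rate n p k \<delta>"
proof -
  have "real k * 1 \<le> real p * (9 * exp 1)"
    using assms exp_ge_add_one_self[of "1::real"] by (intro mult_mono) auto
  hence "1 \<le> 9 * exp 1 * real p / real k"
    using assms by (simp add: field_simps)
  thus ?thesis
    using assms by (auto simp: rate_def intro!: divide_nonneg_nonneg add_nonneg_nonneg mult_nonneg_nonneg)
qed

lemma type_I_error:
  assumes n: "1 \<le> n" and k: "1 \<le> k" "k \<le> CARD('p::finite)" and \<delta>: "0 < \<delta>" "\<delta> < 1"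
    and \<tau>: "tau0 n CARD('p) k \<delta> \<le> \<tau>"
  defines "M \<equiv> iid_law n (mvnormal 0 (mat 1 :: real^'p^'p))"
  shows "measure M {X\<in>space M. \<tau> < sparse_max_eig k (emp_cov n X)} \<le> \<delta>"
proof -
  interpret M: prob_space M
    unfolding M_def by (intro prob_space_iid_law prob_space_mvnormal)
  define R where "R = rate n CARD('p) k \<delta>"
  have "0 \<le> R" unfolding R_def using k \<delta> by (rule rate_nonneg)
  \<comment> \<open>With this \<open>u\<close>, \<open>tau0 - 1 = 4 * u + 4 * u\<^sup>2\<close> is
    twice the deviation tested at a net point; the net bound loses exactly this factor 2.\<close>
  define u where "u = sqrt R"
  have u: "0 \<le> u" "u\<^sup>2 = R" using \<open>0 \<le> R\<close> by (auto simp: u_def)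
  have "\<forall>S::'p set. \<exists>N :: (real^'p) set. finite N \<and> N \<subseteq> coord_sphere S \<and> card N \<le> 9 ^ card S
      \<and> (\<forall>x\<in>coord_sphere S. \<exists>y\<in>N. dist x y \<le> 1/4)"
    using ex_coord_sphere_net by metis
  then obtain N :: "'p set \<Rightarrow> (real^'p) set" where N: "\<And>S. finite (N S)" "\<And>S. N S \<subseteq> coord_sphere S"
      "\<And>S. card (N S) \<le> 9 ^ card S" "\<And>S x. x \<in> coord_sphere S \<Longrightarrow> \<exists>y\<in>N S. dist x y \<le> 1/4"
    by metis
  define T where "T = (\<Union>S\<in>{S. card S = k}. N S)"
  have T: "finite T" "\<And>x. x \<in> T \<Longrightarrow> norm x = 1"
    using N(1,2) by (auto simp: T_def coord_sphere_def)
  have "card T \<le> (\<Sum>S\<in>{S::'p set. card S = k}. card (N S))"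
    unfolding T_def by (rule card_UN_le) simp
  also have "\<dots> \<le> (\<Sum>S\<in>{S::'p set. card S = k}. 9 ^ k)"
    by (rule sum_mono) (metis N(3) mem_Collect_eq)
  also have "\<dots> = (CARD('p) choose k) * 9 ^ k"
    using n_subsets[of "UNIV :: 'p set" k] by simp
  finally have card_T: "card T \<le> (CARD('p) choose k) * 9 ^ k" .
  define B where "B = (\<lambda>x. {X\<in>space M. 2 * u + 2 * u\<^sup>2 < \<bar>x \<bullet> ((emp_cov n X - mat 1) *v x)\<bar>})"
  have B: "B x \<in> sets M" "measure M (B x) \<le> 2 * exp (- (real n * R))" if "x \<in> T" for x
    using measure_abs_quadratic_form_deviation[OF n T(2)[OF that] u(1)]
    by (simp_all add: B_def M_def u(2))
  have "{X\<in>space M. \<tau> < sparse_max_eig k (emp_cov n X)} \<subseteq> (\<Union>x\<in>T. B x)"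
  proof
    fix X assume "X \<in> {X\<in>space M. \<tau> < sparse_max_eig k (emp_cov n X)}"
    then obtain v where X: "X \<in> space M" and v: "v \<in> sparse_sphere k" "\<tau> < v \<bullet> (emp_cov n X *v v)"
      by (auto simp: less_sparse_max_eig_iff[OF k(1)])
    obtain S where S: "card S = k" "v \<in> coord_sphere S"
      using v(1) sparse_sphere_subset_coord_spheres[OF k(2)] by blast
    have "v \<bullet> v = 1" using v(1) by (simp add: sparse_sphere_def dot_square_norm)
    hence "v \<bullet> ((emp_cov n X - mat 1) *v v) = v \<bullet> (emp_cov n X *v v) - 1"
      by (simp add: matrix_vector_mult_diff_rdistrib inner_diff_right)
    moreover have "1 + 4 * u + 4 * u\<^sup>2 \<le> \<tau>"
      using \<tau> unfolding u(2) by (simp add: tau0_def u_def R_def)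
    ultimately have large: "2 * (2 * u + 2 * u\<^sup>2) < \<bar>v \<bullet> ((emp_cov n X - mat 1) *v v)\<bar>"
      using v(2) by (smt (verit))
    \<comment> \<open>If no point of the net for the support \<open>S\<close> had a large deviation,
      the net bound would contradict \<open>large\<close> at \<open>v\<close>.\<close>
    have "\<exists>x\<in>N S. X \<in> B x"
    proof (rule ccontr)
      assume "\<not> ?thesis"
      hence "\<bar>y \<bullet> ((emp_cov n X - mat 1) *v y)\<bar> \<le> 2 * u + 2 * u\<^sup>2" if "y \<in> N S" for y
        using that X by (force simp: B_def)
      from quadratic_form_net_bound[OF N(2,4) this S(2)] show False
        using large by simp
    qed
    thus "X \<in> (\<Union>x\<in>T. B x)"
      using S(1) by (auto simp: T_def)
  qed
  hence "measure M {X\<in>space M. \<tau> < sparse_max_eig k (emp_cov n X)} \<le> measure M (\<Union>x\<in>T. B x)"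
    using T(1) B(1) by (intro M.finite_measure_mono) auto
  also have "\<dots> \<le> (\<Sum>x\<in>T. measure M (B x))"
    using T(1) B(1) by (intro M.finite_measure_subadditive_finite) auto
  also have "\<dots> \<le> (\<Sum>x\<in>T. 2 * exp (- (real n * R)))"
    using B(2) by (rule sum_mono)
  also have "\<dots> = real (card T) * (2 * exp (- (real n * R)))"
    by simp
  also have "\<dots> \<le> real ((CARD('p) choose k) * 9 ^ k) * (2 * exp (- (real n * R)))"
    using card_T by (intro mult_right_mono of_nat_mono) auto
  also have "\<dots> = (2 * real (CARD('p) choose k)) * 9 ^ k * exp (- (real n * R))"
    by simp
  also have "\<dots> \<le> (exp 1 * real CARD('p) / real k) ^ k * 9 ^ k * exp (- (real n * R))"
    by (intro mult_right_mono two_mult_binomial_le k(1)) auto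
  also have "(exp 1 * real CARD('p) / real k) ^ k * 9 ^ k = (9 * exp 1 * real CARD('p) / real k) ^ k"
    by (simp add: mult_ac flip: power_mult_distrib)
  also have "(9 * exp 1 * real CARD('p) / real k) ^ k * exp (- (real n * R)) = \<delta>"
    using k n \<delta> by (simp add: R_def exp_rate)
  finally show ?thesis .
qed

text \<open>The planted direction \<open>v\<close> is itself admissible in the supremum, and its
  form is \<open>1 + \<theta>\<close> times a chi-square average. Failure to reject therefore forces
  a lower chi-square deviation.\<close>

lemma type_II_error:
  fixes v :: "real^'p::finite"
  assumes n: "1 \<le> n" and k: "1 \<le> k" and \<delta>: "0 < \<delta>" "\<delta> < 1" and \<theta>: "0 < \<theta>"
    and \<tau>: "\<tau> \<le> tau1 n \<theta> \<delta>" and v: "v \<in> sparse_sphere k"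
  defines "M \<equiv> iid_law n (mvnormal 0 (spiked_cov \<theta> v))"
  shows "measure M {X\<in>space M. \<not> \<tau> < sparse_max_eig k (emp_cov n X)} \<le> \<delta>"
proof -
  let ?L = "mvnormal 0 (spiked_cov \<theta> v)"
  interpret M: prob_space M
    unfolding M_def by (intro prob_space_iid_law prob_space_mvnormal)
  have v1: "norm v = 1" using v by (simp add: sparse_sphere_def)
  define \<sigma> where "\<sigma> = sqrt (1 + \<theta>)"
  have \<sigma>: "\<sigma> > 0" "\<sigma>\<^sup>2 = 1 + \<theta>" using \<theta> by (auto simp: \<sigma>_def)
  have vv: "v \<bullet> v = 1" using v1 by (simp add: dot_square_norm)
  have "outer v v *v v = v"
    using vv by (simp add: outer_def matrix_vector_mult_def vec_eq_iff inner_vec_def mult.assoc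
        flip: sum_distrib_left)
  hence "v \<bullet> (spiked_cov \<theta> v *v v) = \<sigma>\<^sup>2"
    by (simp add: spiked_cov_def matrix_vector_mult_add_rdistrib inner_add_right \<sigma> vv
        flip: scaleR_matrix_vector_assoc)
  hence distr: "distr ?L borel (\<lambda>X. (v \<bullet> X) / \<sigma>) = std_normal_distribution"
    using \<theta> \<sigma>(1) v1 by (intro distr_inner_mvnormal spiked_cov_has_root) auto
  have g: "(\<lambda>X. (v \<bullet> X) / \<sigma>) \<in> borel_measurable ?L" by measurable
  define u where "u = sqrt (ln (1 / \<delta>) / real n)"
  have nonneg: "0 \<le> ln (1 / \<delta>) / real n" using \<delta> by simp
  hence u: "0 \<le> u" by (simp add: u_def)
  define D where "D = {X\<in>space M. (\<Sum>i=1..n. ((v \<bullet> X i) / \<sigma>)\<^sup>2) \<le> real n * (1 - 2 * u)}"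
  have meas: "(\<lambda>X. \<Sum>i=1..n. ((v \<bullet> X i) / \<sigma>)\<^sup>2) \<in> borel_measurable M"
    unfolding M_def by measurable
  note [measurable] = meas
  have "{X\<in>space M. \<not> \<tau> < sparse_max_eig k (emp_cov n X)} \<subseteq> D"
  proof
    fix X assume "X \<in> {X\<in>space M. \<not> \<tau> < sparse_max_eig k (emp_cov n X)}"
    hence X: "X \<in> space M" and "v \<bullet> (emp_cov n X *v v) \<le> \<tau>"
      using v by (force simp: less_sparse_max_eig_iff[OF k])+
    \<comment> \<open>\<open>tau1\<close> factors as \<open>(1 + \<theta>) * (1 - 2 * u)\<close>,
      the lower-tail threshold scaled by the variance along \<open>v\<close>.\<close>
    hence "(\<Sum>i=1..n. (v \<bullet> X i)\<^sup>2) / real n \<le> \<sigma>\<^sup>2 * (1 - 2 * u)"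
      using \<tau> by (simp add: quadratic_form_emp_cov tau1_def \<sigma> u_def algebra_simps)
    hence "(\<Sum>i=1..n. (v \<bullet> X i)\<^sup>2) / \<sigma>\<^sup>2 \<le> real n * (1 - 2 * u)"
      using n \<sigma>(1) by (simp add: pos_divide_le_eq mult_ac)
    thus "X \<in> D"
      using X by (simp add: D_def power_divide sum_divide_distrib)
  qed
  hence "measure M {X\<in>space M. \<not> \<tau> < sparse_max_eig k (emp_cov n X)} \<le> measure M D"
    unfolding D_def by (rule M.finite_measure_mono) measurable
  also have "\<dots> \<le> exp (- (real n * u\<^sup>2))"
    unfolding D_def M_def by (intro chi_square_lower_tail prob_space_mvnormal g distr u)
  also have "\<dots> = \<delta>"
    using nonneg n \<delta> by (simp add: u_def ln_div)
  finally show ?thesis .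
qed

theorem theorem4p1:
  fixes n k :: nat and \<delta> \<theta> \<tau> :: real
  assumes "n \<ge> 1" and "k \<ge> 1" and "k \<le> CARD('p::finite)"
    and "0 < \<delta>" and "\<delta> < 1"
    and "theta_bar n CARD('p) k \<delta> \<le> 1"
    and "\<theta> > 0" and "\<theta> > theta_bar n CARD('p) k \<delta>"
    and "\<tau> \<in> {tau0 n CARD('p) k \<delta> .. tau1 n \<theta> \<delta>}"
  shows "discriminates n k \<theta> \<delta> (sparse_eig_test k \<tau> :: real^'p^'p \<Rightarrow> nat)"
  unfolding discriminates_def
proof (intro conjI ballI)
  show "(sparse_eig_test k \<tau> :: real^'p^'p \<Rightarrow> nat) \<in> borel \<rightarrow>\<^sub>M count_space {0, 1}"
    using assms(2) by (rule measurable_sparse_eig_test)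
  show "\<P>(X in iid_law n (mvnormal 0 (mat 1 :: real^'p^'p)). sparse_eig_test k \<tau> (emp_cov n X) = 1) \<le> \<delta>"
    using type_I_error[where 'p = 'p, of n k \<delta> \<tau>] assms
    by (simp only: sparse_eig_test_def of_bool_eq_1_iff atLeastAtMost_iff)
  show "\<P>(X in iid_law n (mvnormal 0 (spiked_cov \<theta> v)). sparse_eig_test k \<tau> (emp_cov n X) = 0) \<le> \<delta>"
    if "v \<in> sparse_sphere k" for v :: "real^'p"
    using type_II_error[of n k \<delta> \<theta> \<tau> v] assms that
    by (simp only: sparse_eig_test_def of_bool_eq_0_iff atLeastAtMost_iff)
qed

end
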